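(* For every $p$ with $0\le p<1$, the $H^p$ quasinorm on the space of real $2\times2$ matrices satisfies the triangle inequality: $\|A+B\|_{H^p}\le\|A\|_{H^p}+\|B\|_{H^p}$ for all $A,B\in\mathbb R^{2\times2}$.
   Context: Let $\mathbb S$ be the unit circle in $\mathbb R^2$ and $\mu$ the normalized arclength measure on $\mathbb S$ (total mass $1$). For $A\in\mathbb R^{2\times2}$ and $0<p<\infty$, $\|A\|_{H^p}=\left(\int_{\mathbb S}\|Ax\|^p\,d\mu(x)\right)^{1/p}$, where $\|Ax\|$ is the Euclidean norm; for $p=0$, $\|A\|_{H^0}=\exp\left(\int_{\mathbb S}\log\|Ax\|\,d\mu(x)\right)$, with the convention $\exp(-\infty)=0$, so that the zero matrix has $\|0\|_{H^0}=0$. *)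

theory Defs
  imports "HOL-Analysis.Analysis"
begin

definition circle_param :: "real \<Rightarrow> real^2" where
  "circle_param t = vector [cos t, sin t]"

text \<open>Normalized arclength on the unit circle, regarded as a Borel probability measure on the plane
  that is concentrated on the circle. The parametrization has unit speed, so arclength is the image of
  Lebesgue measure on an interval of length \<open>2 * pi\<close>.\<close>

definition circle_measure :: "(real^2) measure" where
  "circle_measure = distr (uniform_measure lborel {0..2*pi}) borel circle_param"

lemma circle_param_measurable [measurable]: "circle_param \<in> borel_measurable borel"
proof -
  have "continuous_on UNIV circle_param"
    unfolding circle_param_def
    by (subst continuous_on_componentwise) 
       (auto simp: Basis_vec_def inner_axis forall_2 intro!: continuous_intros)
  then show ?thesis by (rule borel_measurable_continuous_onI)
qed

lemma prob_space_circle_measure: "emeasure circle_measure UNIV = 1"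
  by (simp add: circle_measure_def emeasure_distr)

lemma circle_measure_sphere: "AE x in circle_measure. x \<in> sphere 0 1"
proof -
  have "circle_param t \<in> sphere 0 1" for t
    by (simp add: circle_param_def norm_vec_def L2_set_def sum_2)
  then show ?thesis
    unfolding circle_measure_def
    by (subst AE_distr_iff) auto
qed

text \<open>The integrand for exponent zero may take the value \<open>-\<infinity>\<close>, whereas the library logarithm on the
  reals satisfies \<open>ln 0 = 0\<close>; hence an extended logarithm, an extended-real integral (positive part
  minus negative part) and an extended exponential.\<close>

definition elog :: "real \<Rightarrow> ereal" where
  "elog r = (if r > 0 then ereal (ln r) else -\<infinity>)"

definition ereal_integral :: "'a measure \<Rightarrow> ('a \<Rightarrow> ereal) \<Rightarrow> ereal" where
  "ereal_integral M f =
     enn2ereal (\<integral>\<^sup>+x. e2ennreal (f x) \<partial>M) - enn2ereal (\<integral>\<^sup>+x. e2ennreal (- f x) \<partial>M)"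

text \<open>The argument \<open>\<infinity>\<close> does not occur below, since the integrand is bounded above on the circle.\<close>

definition eexp :: "ereal \<Rightarrow> real" where
  "eexp a = (if a = -\<infinity> then 0 else exp (real_of_ereal a))"

definition Hp_norm :: "real \<Rightarrow> real^2^2 \<Rightarrow> real" where
  "Hp_norm p A =
     (if p = 0 then eexp (ereal_integral circle_measure (\<lambda>x. elog (norm (A *v x))))
      else (\<integral>x. norm (A *v x) powr p \<partial>circle_measure) powr (1 / p))"

lemma Hp_norm_zero_matrix: "Hp_norm p 0 = 0"
proof -
  have [simp]: "emeasure circle_measure (space circle_measure) = 1"
    using prob_space_circle_measure by (simp add: circle_measure_def)
  have "e2ennreal (-\<infinity>) = 0" "e2ennreal \<infinity> = \<infinity>"
    by (simp_all add: e2ennreal_neg e2ennreal_infty)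
  then show ?thesis
    by (simp add: Hp_norm_def eexp_def ereal_integral_def elog_def zero_ennreal.rep_eq)
qed

lemma eexp_integral_elog_real:
  assumes "integrable M (\<lambda>x. ln (f x))" "AE x in M. f x > 0"
  shows "eexp (ereal_integral M (\<lambda>x. elog (f x))) = exp (\<integral>x. ln (f x) \<partial>M)"
proof -
  have "(\<integral>\<^sup>+x. e2ennreal (elog (f x)) \<partial>M) = (\<integral>\<^sup>+x. ennreal (ln (f x)) \<partial>M)"
    and "(\<integral>\<^sup>+x. e2ennreal (- elog (f x)) \<partial>M) = (\<integral>\<^sup>+x. ennreal (- ln (f x)) \<partial>M)"
    using assms(2) by (auto intro!: nn_integral_cong_AE simp: elog_def)
  moreover obtain a where a: "(\<integral>\<^sup>+x. ennreal (ln (f x)) \<partial>M) = ennreal a" "a \<ge> 0"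
    using assms(1) unfolding real_integrable_def
    by (metis ennreal_cases infinity_ennreal_def)
  moreover obtain b where b: "(\<integral>\<^sup>+x. ennreal (- ln (f x)) \<partial>M) = ennreal b" "b \<ge> 0"
    using assms(1) unfolding real_integrable_def
    by (metis ennreal_cases infinity_ennreal_def)
  ultimately show ?thesis
    using real_lebesgue_integral_def[OF assms(1)]
    by (simp add: ereal_integral_def eexp_def enn2ereal_ennreal)
qed

end

theory Submission
  imports Defs
begin

text \<open>Write \<open>A z = a z + b cnj z\<close> on \<open>\<complex>\<close>. On the circle \<open>\<bar>A z\<bar>\<close> is distributed as
  \<open>chord r s t = \<bar>r + s e\<^sup>i\<^sup>t\<bar>\<close> with \<open>r = \<bar>a\<bar>\<close>, \<open>s = \<bar>b\<bar>\<close> and \<open>t\<close> uniform, so \<open>\<parallel>A\<parallel> = F r s\<close> for a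
  symmetric homogeneous \<open>F\<close>, and it suffices that \<open>F\<close> is increasing and subadditive on the quadrant.

  For \<open>p = 0\<close>, Jensen's formula gives \<open>F r s = max r s\<close>.

  For \<open>0 < p < 1\<close> and \<open>0 \<le> x < 1\<close>, Parseval applied to the binomial series of \<open>(1 + x e\<^sup>i\<^sup>t)\<close> to the
  power \<open>p / 2\<close> writes \<open>(F 1 x)\<close> to the power \<open>p\<close> as a power series in \<open>x\<^sup>2\<close> with nonnegative coefficients.
  It is therefore increasing and convex, and so is its power \<open>F 1 x\<close> because \<open>1 / p > 1\<close>. By
  homogeneity \<open>F\<close> is subadditive on the sector \<open>s \<le> r\<close>, and by symmetry on \<open>r \<le> s\<close>. For pairs in
  different sectors, reflect one of them: with \<open>r + s\<close> fixed, \<open>F r s\<close> grows with \<open>\<bar>r - s\<bar>\<close>, even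
  pointwise under the integral.\<close>

section \<open>Averages over a uniform angle\<close>

abbreviation angle_measure :: "real measure" where
  "angle_measure \<equiv> uniform_measure lborel {0..2*pi}"

lemma finite_measure_angle: "finite_measure angle_measure"
  by (rule finite_measureI) (simp add: ennreal_divide_eq_top_iff)

lemma integral_cos_angle:
  fixes m :: int
  shows "(\<integral>t. cos (of_int m * t) \<partial>angle_measure) = of_bool (m = 0)"
proof (cases "m = 0")
  case True
  then show ?thesis
    by (simp add: measure_def)
next
  case False
  have "(\<integral>t. cos (of_int m * t) * indicator {0..2*pi} t \<partial>lborel)
      = sin (of_int m * (2*pi)) / of_int m - sin (of_int m * 0) / of_int m"
    by (rule integral_FTC_Icc_real) (use False in \<open>auto intro!: derivative_eq_intros continuous_intros\<close>)
  also have "\<dots> = 0"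
    using sin_int_2pin[of m] by (simp add: mult_ac)
  finally have *: "(\<integral>t. cos (of_int m * t) * indicator {0..2*pi} t \<partial>lborel) = 0" .
  \<comment> \<open>With a real-valued density the mean becomes a multiple of the
    \<open>lborel\<close> integral just computed.\<close>
  have "angle_measure = density lborel (\<lambda>t. ennreal (indicator {0..2*pi} t / (2*pi)))"
    unfolding uniform_measure_def
    by (intro arg_cong[where f = "density lborel"] ext)
       (auto simp: divide_ennreal ennreal_1[symmetric] simp del: ennreal_1 split: split_indicator)
  then have "(\<integral>t. cos (of_int m * t) \<partial>angle_measure)
      = (\<integral>t. (indicator {0..2*pi} t / (2*pi)) *\<^sub>R cos (of_int m * t) \<partial>lborel)"
    by (simp only:) (rule integral_density; auto)
  also have "\<dots> = (\<integral>t. cos (of_int m * t) * indicator {0..2*pi} t / (2*pi) \<partial>lborel)"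
    by (simp add: mult.commute)
  finally show ?thesis
    using * False by simp
qed

text \<open>The substitution \<open>x = 2*t + \<phi>\<close> maps the interval onto one of length
  \<open>4*pi\<close>. This covers two periods, and the Jacobian halves the result.\<close>

lemma nn_integral_periodic_double_angle:
  fixes h :: "real \<Rightarrow> ennreal"
  assumes [measurable]: "h \<in> borel_measurable borel"
    and per: "\<And>x. h (x + 2*pi) = h x" and \<phi>: "0 \<le> \<phi>" "\<phi> < 2*pi"
  shows "(\<integral>\<^sup>+t. h (2*t + \<phi>) \<partial>angle_measure) = (\<integral>\<^sup>+t. h t \<partial>angle_measure)"
proof -
  define I where "I a b = (\<integral>\<^sup>+x. h x * indicator {a..<b} x \<partial>lborel)" for a b
  have shift: "I (a + 2*pi) (b + 2*pi) = I a b" for a b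
  proof -
    have "I (a + 2*pi) (b + 2*pi)
        = (\<integral>\<^sup>+x. h (2*pi + 1*x) * indicator {a + 2*pi..<b + 2*pi} (2*pi + 1*x) \<partial>lborel)"
      unfolding I_def by (subst nn_integral_real_affine[where c = 1 and t = "2*pi"]) auto
    also have "\<dots> = I a b"
      unfolding I_def using per
      by (intro nn_integral_cong) (auto simp: add.commute split: split_indicator)
    finally show ?thesis .
  qed
  have split: "I a c = I a b + I b c" if "a \<le> b" "b \<le> c" for a b c
  proof -
    have "I a c = (\<integral>\<^sup>+x. h x * indicator {a..<b} x + h x * indicator {b..<c} x \<partial>lborel)"
      unfolding I_def using that by (intro nn_integral_cong) (auto split: split_indicator)
    then show ?thesis
      unfolding I_def by (simp add: nn_integral_add)
  qed
  \<comment> \<open>Half-open intervals concatenate without overlap. The closed interval of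
    \<open>angle_measure\<close> differs from them by a null set.\<close>
  have closed: "(\<integral>\<^sup>+x. g x * indicator {a..b} x \<partial>lborel) = (\<integral>\<^sup>+x. g x * indicator {a..<b} x \<partial>lborel)"
    for g :: "real \<Rightarrow> ennreal" and a b
    using AE_lborel_singleton[of b]
    by (intro nn_integral_cong_AE) (auto split: split_indicator)
  have "I \<phi> (\<phi> + 4*pi) = 2 * (\<integral>\<^sup>+x. h (\<phi> + 2*x) * indicator {\<phi>..<\<phi> + 4*pi} (\<phi> + 2*x) \<partial>lborel)"
    unfolding I_def by (subst nn_integral_real_affine[where c = 2 and t = \<phi>]) auto
  also have "(\<integral>\<^sup>+x. h (\<phi> + 2*x) * indicator {\<phi>..<\<phi> + 4*pi} (\<phi> + 2*x) \<partial>lborel)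
      = (\<integral>\<^sup>+x. h (2*x + \<phi>) * indicator {0..<2*pi} x \<partial>lborel)"
    by (intro nn_integral_cong) (auto simp: add.commute split: split_indicator)
  finally have 1: "I \<phi> (\<phi> + 4*pi) = 2 * (\<integral>\<^sup>+x. h (2*x + \<phi>) * indicator {0..2*pi} x \<partial>lborel)"
    by (simp add: closed)
  \<comment> \<open>Cut at the multiples of \<open>2*pi\<close>: the middle piece is one period, and
    the two outer pieces shift together to another one.\<close>
  have "I \<phi> (\<phi> + 4*pi) = I \<phi> (2*pi) + I (2*pi) (4*pi) + I (4*pi) (\<phi> + 4*pi)"
    using \<phi> split[of \<phi> "2*pi" "4*pi"] split[of \<phi> "4*pi" "\<phi> + 4*pi"] by simp
  also have "I (2*pi) (4*pi) = I 0 (2*pi)"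
    using shift[of 0 "2*pi"] by simp
  also have "I (4*pi) (\<phi> + 4*pi) = I 0 \<phi>"
    using shift[of 0 \<phi>] shift[of "2*pi" "\<phi> + 2*pi"] by (simp add: add.assoc)
  also have "I \<phi> (2*pi) + I 0 (2*pi) + I 0 \<phi> = 2 * I 0 (2*pi)"
  proof -
    have "I 0 (2*pi) = I 0 \<phi> + I \<phi> (2*pi)"
      using \<phi> by (intro split) auto
    then show ?thesis
      by (simp only: mult_2 add_ac)
  qed
  finally have "2 * (\<integral>\<^sup>+x. h (2*x + \<phi>) * indicator {0..2*pi} x \<partial>lborel) = 2 * I 0 (2*pi)"
    using 1 by simp
  then have "(\<integral>\<^sup>+x. h (2*x + \<phi>) * indicator {0..2*pi} x \<partial>lborel)
      = (\<integral>\<^sup>+x. h x * indicator {0..2*pi} x \<partial>lborel)"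
    unfolding I_def by (simp add: closed ennreal_mult_cancel_left)
  then show ?thesis
    by (simp add: nn_integral_uniform_measure)
qed

section \<open>From matrices to chords\<close>

text \<open>Identifying the plane with \<open>\<complex>\<close>, the matrix acts as \<open>z \<mapsto> a z + b cnj z\<close>.\<close>

definition hol_part :: "real^2^2 \<Rightarrow> complex" where
  "hol_part A = Complex ((A$1$1 + A$2$2) / 2) ((A$2$1 - A$1$2) / 2)"

definition antihol_part :: "real^2^2 \<Rightarrow> complex" where
  "antihol_part A = Complex ((A$1$1 - A$2$2) / 2) ((A$2$1 + A$1$2) / 2)"

lemma hol_part_add: "hol_part (A + B) = hol_part A + hol_part B"
  by (simp add: hol_part_def complex_eq_iff add_divide_distrib diff_divide_distrib)

lemma antihol_part_add: "antihol_part (A + B) = antihol_part A + antihol_part B"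
  by (simp add: antihol_part_def complex_eq_iff add_divide_distrib diff_divide_distrib)

lemma norm_matrix_circle_param:
  "norm (A *v circle_param t) = cmod (hol_part A * cis t + antihol_part A * cis (- t))"
proof -
  have "norm (A *v circle_param t) = cmod (Complex ((A *v circle_param t)$1) ((A *v circle_param t)$2))"
    by (simp add: norm_vec_def L2_set_def sum_2 complex_norm)
  also have "Complex ((A *v circle_param t)$1) ((A *v circle_param t)$2)
      = hol_part A * cis t + antihol_part A * cis (- t)"
    by (simp add: complex_eq_iff hol_part_def antihol_part_def matrix_vector_mult_def sum_2
        circle_param_def) (simp add: field_simps)
  finally show ?thesis .
qed

text \<open>The law of cosines for \<open>r + s e^(it)\<close>. The real form suits measurability
  and comparison of radicands; the complex form in \<open>chord_eq_cmod\<close> suits scaling,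
  limits and series.\<close>

definition chord :: "real \<Rightarrow> real \<Rightarrow> real \<Rightarrow> real" where
  "chord r s t = sqrt (r\<^sup>2 + s\<^sup>2 + 2 * r * s * cos t)"

lemma chord_eq_cmod: "chord r s t = cmod (of_real r + of_real s * cis t)"
proof -
  have "(r + s * cos t)\<^sup>2 + (s * sin t)\<^sup>2 = r\<^sup>2 + s\<^sup>2 * ((cos t)\<^sup>2 + (sin t)\<^sup>2) + 2 * r * s * cos t"
    unfolding power2_eq_square by algebra
  then show ?thesis
    by (simp add: chord_def cmod_def)
qed

lemma chord_measurable [measurable]: "chord r s \<in> borel_measurable borel"
  unfolding chord_def by simp

lemma cmod_add_sq: "(cmod (z + w))\<^sup>2 = (cmod z)\<^sup>2 + (cmod w)\<^sup>2 + 2 * Re (z * cnj w)"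
  unfolding cmod_power2 by (simp add: power2_eq_square algebra_simps)

text \<open>Expanding the square, \<open>t\<close> enters only through the real part of
  \<open>a * cnj b * e^(2it)\<close>, so the phase is the argument of \<open>a * cnj b\<close>.
  \<open>Arg2pi\<close> places it in the range that \<open>nn_integral_periodic_double_angle\<close>
  expects.\<close>

lemma cmod_double_phase:
  "\<exists>\<phi>. 0 \<le> \<phi> \<and> \<phi> < 2*pi \<and> (\<forall>t. cmod (a * cis t + b * cis (- t)) = chord (cmod a) (cmod b) (2*t + \<phi>))"
proof (intro exI[of _ "Arg2pi (a * cnj b)"] conjI allI)
  fix t
  define \<phi> where "\<phi> = Arg2pi (a * cnj b)"
  have ab: "a * cnj b = of_real (cmod a * cmod b) * cis \<phi>"
    using Arg2pi_eq[of "a * cnj b"] by (simp add: \<phi>_def norm_mult cis_conv_exp mult.commute)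
  have "(cmod (a * cis t + b * cis (- t)))\<^sup>2
      = (cmod a)\<^sup>2 + (cmod b)\<^sup>2 + 2 * Re (a * cis t * cnj (b * cis (- t)))"
    by (simp only: cmod_add_sq norm_mult norm_cis mult_1_right)
  also have "a * cis t * cnj (b * cis (- t)) = of_real (cmod a * cmod b) * cis (2*t + \<phi>)"
  proof -
    have "a * cis t * cnj (b * cis (- t)) = (a * cnj b) * (cis t * cis t)"
      by (simp add: cis_cnj mult_ac)
    then show ?thesis
      unfolding ab by (simp add: cis_mult mult.assoc add.commute)
  qed
  finally have "(cmod (a * cis t + b * cis (- t)))\<^sup>2
      = (cmod a)\<^sup>2 + (cmod b)\<^sup>2 + 2 * cmod a * cmod b * cos (2*t + \<phi>)"
    by simp
  then show "cmod (a * cis t + b * cis (- t)) = chord (cmod a) (cmod b) (2*t + Arg2pi (a * cnj b))"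
    by (simp add: chord_def flip: \<phi>_def) (metis norm_ge_zero real_sqrt_unique)
qed (auto simp: Arg2pi_ge_0 Arg2pi_lt_2pi)

lemma matrix_vector_mult_measurable [measurable]:
  fixes A :: "real^2^2"
  shows "(\<lambda>x. A *v x) \<in> borel_measurable borel"
  by (intro borel_measurable_continuous_onI linear_continuous_on)
     (simp add: linear_conv_bounded_linear matrix_vector_mul_linear)

text \<open>Nonnegative integrals let one identity serve both the powers and the positive and
  negative parts of \<open>elog\<close>, whose integrals may be infinite.\<close>

lemma nn_integral_circle_measure:
  fixes g :: "real \<Rightarrow> ennreal"
  assumes [measurable]: "g \<in> borel_measurable borel"
  shows "(\<integral>\<^sup>+x. g (norm (A *v x)) \<partial>circle_measure)
       = (\<integral>\<^sup>+t. g (chord (cmod (hol_part A)) (cmod (antihol_part A)) t) \<partial>angle_measure)"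
proof -
  obtain \<phi> where \<phi>: "0 \<le> \<phi>" "\<phi> < 2*pi"
    and *: "\<And>t. norm (A *v circle_param t) = chord (cmod (hol_part A)) (cmod (antihol_part A)) (2*t + \<phi>)"
    using cmod_double_phase[of "hol_part A" "antihol_part A"] by (auto simp: norm_matrix_circle_param)
  have "(\<integral>\<^sup>+x. g (norm (A *v x)) \<partial>circle_measure)
      = (\<integral>\<^sup>+t. g (chord (cmod (hol_part A)) (cmod (antihol_part A)) (2*t + \<phi>)) \<partial>angle_measure)"
    unfolding circle_measure_def by (subst nn_integral_distr) (simp_all add: *)
  also have "\<dots> = (\<integral>\<^sup>+t. g (chord (cmod (hol_part A)) (cmod (antihol_part A)) t) \<partial>angle_measure)"
    by (rule nn_integral_periodic_double_angle) (simp_all add: \<phi> chord_def)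
  finally show ?thesis .
qed

lemma elog_measurable [measurable]: "elog \<in> borel_measurable borel"
  unfolding elog_def by measurable

lemma Hp_norm_0_eq_chord:
  "Hp_norm 0 A = eexp (ereal_integral angle_measure
     (\<lambda>t. elog (chord (cmod (hol_part A)) (cmod (antihol_part A)) t)))"
  unfolding Hp_norm_def ereal_integral_def
  using nn_integral_circle_measure[of "\<lambda>r. e2ennreal (elog r)" A]
    nn_integral_circle_measure[of "\<lambda>r. e2ennreal (- elog r)" A] by simp

definition chord_moment :: "real \<Rightarrow> real \<Rightarrow> real \<Rightarrow> real" where
  "chord_moment p r s = (\<integral>t. chord r s t powr p \<partial>angle_measure)"

lemma Hp_norm_eq_chord_moment:
  assumes "p \<noteq> 0"
  shows "Hp_norm p A = chord_moment p (cmod (hol_part A)) (cmod (antihol_part A)) powr (1 / p)"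
proof -
  have "(\<integral>x. norm (A *v x) powr p \<partial>circle_measure)
      = enn2real (\<integral>\<^sup>+x. ennreal (norm (A *v x) powr p) \<partial>circle_measure)"
    by (intro integral_eq_nn_integral) (auto simp: circle_measure_def)
  also have "\<dots> = enn2real (\<integral>\<^sup>+t. ennreal (chord (cmod (hol_part A)) (cmod (antihol_part A)) t powr p) \<partial>angle_measure)"
    by (subst nn_integral_circle_measure[of "\<lambda>r. ennreal (r powr p)"]) auto
  also have "\<dots> = chord_moment p (cmod (hol_part A)) (cmod (antihol_part A))"
    unfolding chord_moment_def by (subst integral_eq_nn_integral) auto
  finally show ?thesis
    using assms by (simp add: Hp_norm_def)
qed

section \<open>Pointwise comparison of chords and basic properties of their moments\<close>

lemma chord_nonneg [simp]: "chord r s t \<ge> 0"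
  by (simp add: chord_eq_cmod)

lemma chord_commute: "chord r s = chord s r"
  by (rule ext) (simp add: chord_def algebra_simps)

lemma chord_scale: "c \<ge> 0 \<Longrightarrow> chord (c * r) (c * s) t = c * chord r s t"
proof -
  assume "c \<ge> 0"
  have "of_real (c * r) + of_real (c * s) * cis t = of_real c * (of_real r + of_real s * cis t)"
    by (simp add: algebra_simps)
  then show ?thesis
    using \<open>c \<ge> 0\<close> unfolding chord_eq_cmod by (simp add: norm_mult)
qed

lemma chord_le: "chord r s t \<le> \<bar>r\<bar> + \<bar>s\<bar>"
  unfolding chord_eq_cmod using norm_triangle_ineq[of "of_real r" "of_real s * cis t"]
  by (simp add: norm_mult)

text \<open>The radicands differ by \<open>(r' - r) * (r' + r + 2 * s * cos t)\<close>, and both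
  \<open>r\<close> and \<open>r'\<close> dominate \<open>s\<close>. For \<open>r < s\<close>
  pointwise monotonicity can fail, for example at \<open>t = pi\<close>; the averaged version there
  rests on the power series.\<close>

lemma chord_mono_left:
  assumes "0 \<le> s" "s \<le> r" "r \<le> r'"
  shows "chord r s t \<le> chord r' s t"
proof -
  have one_cos: "0 \<le> 1 + cos t"
    using cos_ge_minus_one[of t] by linarith
  have "0 \<le> (r' - r) * ((r' - s) + (r - s) + 2 * s * (1 + cos t))"
    using assms one_cos
    by (intro mult_nonneg_nonneg[of "r' - r"] add_nonneg_nonneg[of "(r' - s) + (r - s)"]
        mult_nonneg_nonneg[of "2 * s"]) auto
  then show ?thesis
    unfolding chord_def by (intro real_sqrt_le_mono) (simp add: power2_eq_square algebra_simps)
qed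

text \<open>The squared chord is \<open>(r + s)^2 - 2 * r * s * (1 - cos t)\<close>, so for a fixed
  sum it decreases in the product.\<close>

lemma chord_mono_spread:
  assumes "r + s = r' + s'" "r' * s' \<le> r * s"
  shows "chord r s t \<le> chord r' s' t"
proof -
  have eq: "x\<^sup>2 + y\<^sup>2 + 2 * x * y * cos t = (x + y)\<^sup>2 - 2 * (x * y) * (1 - cos t)" for x y :: real
    by (simp add: power2_eq_square algebra_simps)
  show ?thesis
    unfolding chord_def eq assms(1) using assms(2) cos_le_one[of t]
    by (intro real_sqrt_le_mono diff_left_mono mult_right_mono) auto
qed

lemma integrable_chord_powr:
  assumes "p \<ge> 0"
  shows "integrable angle_measure (\<lambda>t. chord r s t powr p)"
proof (rule finite_measure.integrable_const_bound[OF finite_measure_angle])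
  show "AE t in angle_measure. norm (chord r s t powr p) \<le> (\<bar>r\<bar> + \<bar>s\<bar>) powr p"
    using assms by (auto intro!: AE_I2 powr_mono2 chord_le)
qed auto

lemma chord_moment_mono:
  assumes "p \<ge> 0" "\<And>t. chord r s t \<le> chord r' s' t"
  shows "chord_moment p r s \<le> chord_moment p r' s'"
  unfolding chord_moment_def
  using assms by (intro integral_mono integrable_chord_powr powr_mono2) auto

lemma chord_moment_commute: "chord_moment p r s = chord_moment p s r"
  by (simp add: chord_moment_def chord_commute[of r s])

lemma chord_moment_scale:
  "c \<ge> 0 \<Longrightarrow> chord_moment p (c * r) (c * s) = c powr p * chord_moment p r s"
  unfolding chord_moment_def by (simp add: chord_scale powr_mult)

lemma chord_moment_nonneg: "chord_moment p r s \<ge> 0"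
  unfolding chord_moment_def by simp

lemma measure_angle_UNIV [simp]: "measure angle_measure UNIV = 1"
  using integral_cos_angle[of 0] by simp

lemma chord_moment_1_0: "chord_moment p 1 0 = 1"
  by (simp add: chord_moment_def chord_def)

section \<open>Parseval and the power series of the moment\<close>

lemma cmod_sum_cis_squared:
  fixes a :: "nat \<Rightarrow> real"
  shows "(cmod (\<Sum>n<N. of_real (a n) * cis (real n * t)))\<^sup>2
       = (\<Sum>i<N. \<Sum>j<N. a i * a j * cos (of_int (int i - int j) * t))"
proof -
  let ?w = "\<Sum>n<N. of_real (a n) * cis (real n * t)"
  have "(cmod ?w)\<^sup>2 = Re (?w * cnj ?w)"
    by (metis Re_complex_of_real complex_norm_square)
  also have "?w * cnj ?w = (\<Sum>i<N. \<Sum>j<N. (of_real (a i) * cis (real i * t)) * cnj (of_real (a j) * cis (real j * t)))"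
    by (simp only: cnj_sum sum_product)
  also have "\<dots> = (\<Sum>i<N. \<Sum>j<N. of_real (a i * a j) * cis (of_int (int i - int j) * t))"
    by (intro sum.cong refl) (simp add: cis_cnj cis_mult algebra_simps)
  finally show ?thesis
    by simp
qed

lemma integrable_cos_angle: "integrable angle_measure (\<lambda>t. cos (m * t))"
  by (rule finite_measure.integrable_const_bound[OF finite_measure_angle, where B = 1]) auto

lemma integral_cmod_sum_cis_squared:
  fixes a :: "nat \<Rightarrow> real"
  shows "(\<integral>t. (cmod (\<Sum>n<N. of_real (a n) * cis (real n * t)))\<^sup>2 \<partial>angle_measure) = (\<Sum>n<N. (a n)\<^sup>2)"
proof -
  have "(\<integral>t. (cmod (\<Sum>n<N. of_real (a n) * cis (real n * t)))\<^sup>2 \<partial>angle_measure)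
      = (\<Sum>i<N. \<Sum>j<N. a i * a j * of_bool (int i - int j = 0))"
    unfolding cmod_sum_cis_squared integral_cos_angle[symmetric]
    by (simp add: integrable_cos_angle del: of_int_diff)
  also have "\<dots> = (\<Sum>i<N. \<Sum>j<N. if i = j then a i * a j else 0)"
    by (intro sum.cong) auto
  also have "\<dots> = (\<Sum>n<N. (a n)\<^sup>2)"
    by (simp add: power2_eq_square)
  finally show ?thesis .
qed

text \<open>All partial sums are bounded by the sum of the \<open>\<bar>a n\<bar>\<close>, so
  dominated convergence carries Parseval from trigonometric polynomials to the limit.\<close>

lemma parseval_abs_summable:
  fixes a :: "nat \<Rightarrow> real"
  assumes sm: "summable (\<lambda>n. \<bar>a n\<bar>)"
    and f: "\<And>t. (\<lambda>n. of_real (a n) * cis (real n * t)) sums f t"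
  shows "(\<lambda>N. \<Sum>n<N. (a n)\<^sup>2) \<longlonglongrightarrow> (\<integral>t. (cmod (f t))\<^sup>2 \<partial>angle_measure)"
proof -
  have "(\<lambda>N. \<integral>t. (cmod (\<Sum>n<N. of_real (a n) * cis (real n * t)))\<^sup>2 \<partial>angle_measure)
      \<longlonglongrightarrow> (\<integral>t. (cmod (f t))\<^sup>2 \<partial>angle_measure)"
  proof (rule integral_dominated_convergence[where w = "\<lambda>_. (\<Sum>n. \<bar>a n\<bar>)\<^sup>2"])
    have lim: "(\<lambda>N. (cmod (\<Sum>n<N. of_real (a n) * cis (real n * t)))\<^sup>2) \<longlonglongrightarrow> (cmod (f t))\<^sup>2" for t :: real
      using f[of t] unfolding sums_def by (intro tendsto_intros)
    then show "AE t in angle_measure. (\<lambda>N. (cmod (\<Sum>n<N. of_real (a n) * cis (real n * t)))\<^sup>2) \<longlonglongrightarrow> (cmod (f t))\<^sup>2"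
      by simp
    show meas: "(\<lambda>t. (cmod (\<Sum>n<N. of_real (a n) * cis (real n * t)))\<^sup>2) \<in> borel_measurable angle_measure" for N
      unfolding cmod_sum_cis_squared by measurable
    show "(\<lambda>t. (cmod (f t))\<^sup>2) \<in> borel_measurable angle_measure"
      by (rule borel_measurable_LIMSEQ_real[OF lim meas])
    show "integrable angle_measure (\<lambda>_. (\<Sum>n. \<bar>a n\<bar>)\<^sup>2)"
      by (simp add: finite_measure.integrable_const[OF finite_measure_angle])
    show "AE t in angle_measure. norm ((cmod (\<Sum>n<N. of_real (a n) * cis (real n * t)))\<^sup>2) \<le> (\<Sum>n. \<bar>a n\<bar>)\<^sup>2" for N
    proof (rule AE_I2)
      fix t
      have "cmod (\<Sum>n<N. of_real (a n) * cis (real n * t)) \<le> (\<Sum>n<N. \<bar>a n\<bar>)"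
        by (rule order_trans[OF norm_sum]) (simp add: norm_mult)
      also have "\<dots> \<le> (\<Sum>n. \<bar>a n\<bar>)"
        by (rule sum_le_suminf[OF sm]) auto
      finally show "norm ((cmod (\<Sum>n<N. of_real (a n) * cis (real n * t)))\<^sup>2) \<le> (\<Sum>n. \<bar>a n\<bar>)\<^sup>2"
        by (simp add: power_mono)
    qed
  qed
  then show ?thesis
    by (simp add: integral_cmod_sum_cis_squared)
qed

text \<open>Parseval for \<open>(1 + x e^(it))\<close> to the power \<open>p / 2\<close>, whose
  squared modulus is \<open>chord 1 x t powr p\<close>. The coefficients appear squared, which makes
  them nonnegative.\<close>

lemma chord_moment_series:
  assumes "0 \<le> x" "x < 1"
  shows "(\<lambda>N. \<Sum>n<N. (p / 2 gchoose n)\<^sup>2 * x ^ (2 * n)) \<longlonglongrightarrow> chord_moment p 1 x"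
proof -
  define a where "a n = (p / 2 gchoose n) * x ^ n" for n
  \<comment> \<open>Convergence at the larger point \<open>(1 + x) / 2 < 1\<close> gives absolute
    convergence at \<open>x\<close>.\<close>
  have "summable (\<lambda>n. norm ((p / 2 gchoose n) * x ^ n))"
  proof (rule powser_insidea)
    show "summable (\<lambda>n. (p / 2 gchoose n) * ((1 + x) / 2) ^ n)"
      using gen_binomial_real[of "(1 + x) / 2" "p / 2"] assms by (auto simp: sums_iff)
  qed (use assms in auto)
  then have sm: "summable (\<lambda>n. \<bar>a n\<bar>)"
    by (simp add: a_def)
  \<comment> \<open>\<open>gbinomial_prod_rev\<close> turns the binomials into products, through
    which \<open>of_real\<close> passes.\<close>
  have "(\<lambda>n. of_real (a n) * cis (real n * t)) sums (1 + of_real x * cis t) powr of_real (p / 2)" for t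
    using gen_binomial_complex[of "of_real x * cis t" "of_real (p / 2)"] assms
    by (simp add: a_def norm_mult power_mult_distrib Complex.DeMoivre gbinomial_prod_rev mult.assoc)
  from parseval_abs_summable[OF sm this]
  have "(\<lambda>N. \<Sum>n<N. (a n)\<^sup>2) \<longlonglongrightarrow>
      (\<integral>t. (cmod ((1 + of_real x * cis t) powr of_real (p / 2)))\<^sup>2 \<partial>angle_measure)" .
  moreover have "(cmod ((1 + of_real x * cis t) powr of_real (p / 2)))\<^sup>2 = chord 1 x t powr p" for t
    by (subst norm_powr_real_powr')
       (simp_all add: chord_eq_cmod power2_eq_square powr_add[symmetric])
  ultimately show ?thesis
    by (simp add: chord_moment_def a_def power_mult_distrib power_mult[symmetric] mult.commute)
qed

text \<open>This reaches the endpoint \<open>x = 1\<close>, outside the range of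
  \<open>chord_moment_series\<close>. Chords with sides at most 1 are bounded by 2, so dominated
  convergence applies.\<close>

lemma chord_moment_radial_limit:
  assumes "p > 0" "0 \<le> x" "x \<le> 1"
  shows "(\<lambda>n. chord_moment p 1 (real n / (real n + 1) * x)) \<longlonglongrightarrow> chord_moment p 1 x"
  unfolding chord_moment_def
proof (rule integral_dominated_convergence[where w = "\<lambda>_. 2 powr p"])
  show "integrable angle_measure (\<lambda>_. 2 powr p)"
    by (simp add: finite_measure.integrable_const[OF finite_measure_angle])
  have "(\<lambda>n. real n / (real n + 1)) \<longlonglongrightarrow> 1"
    using LIMSEQ_n_over_Suc_n by (simp add: add.commute)
  then have *: "(\<lambda>n. real n / (real n + 1) * x) \<longlonglongrightarrow> 1 * x"
    by (intro tendsto_intros)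
  show "AE t in angle_measure. (\<lambda>n. chord 1 (real n / (real n + 1) * x) t powr p) \<longlonglongrightarrow> chord 1 x t powr p"
  proof (rule AE_I2, rule tendsto_powr')
    fix t
    show "(\<lambda>n. chord 1 (real n / (real n + 1) * x) t) \<longlonglongrightarrow> chord 1 x t"
      unfolding chord_eq_cmod using * by (intro tendsto_intros) simp
  qed (use assms in auto)
  fix n
  have "chord 1 (real n / (real n + 1) * x) t \<le> 2" for t
  proof -
    have "real n / (real n + 1) * x \<le> 1"
      using assms by (intro mult_le_one) auto
    then show ?thesis
      using chord_le[of 1 "real n / (real n + 1) * x" t] assms
      by (intro order_trans[OF chord_le]) (simp add: abs_mult)
  qed
  then show "AE t in angle_measure. norm (chord 1 (real n / (real n + 1) * x) t powr p) \<le> 2 powr p"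
    using assms by (auto intro!: AE_I2 powr_mono2)
qed auto

section \<open>Monotonicity and convexity of the moment\<close>

lemma convex_on_pointwise_limit:
  fixes f :: "nat \<Rightarrow> 'a::real_vector \<Rightarrow> real"
  assumes S: "convex S" and f: "\<And>n. convex_on S (f n)" and lim: "\<And>x. x \<in> S \<Longrightarrow> (\<lambda>n. f n x) \<longlonglongrightarrow> g x"
  shows "convex_on S g"
proof (rule convex_onI[OF _ S])
  fix u :: real and x y assume u: "0 < u" "u < 1" and xy: "x \<in> S" "y \<in> S"
  then have m: "(1 - u) *\<^sub>R x + u *\<^sub>R y \<in> S"
    using S by (simp add: convex_def)
  show "g ((1 - u) *\<^sub>R x + u *\<^sub>R y) \<le> (1 - u) * g x + u * g y"
  proof (rule LIMSEQ_le[OF lim[OF m]])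
    show "(\<lambda>n. (1 - u) * f n x + u * f n y) \<longlonglongrightarrow> (1 - u) * g x + u * g y"
      by (intro tendsto_intros lim xy)
    show "\<exists>N. \<forall>n\<ge>N. f n ((1 - u) *\<^sub>R x + u *\<^sub>R y) \<le> (1 - u) * f n x + u * f n y"
      using convex_onD[OF f, of u x y] u xy by auto
  qed
qed

lemma mono_on_pointwise_limit:
  fixes f :: "nat \<Rightarrow> 'a::order \<Rightarrow> real"
  assumes "\<And>n. mono_on S (f n)" "\<And>x. x \<in> S \<Longrightarrow> (\<lambda>n. f n x) \<longlonglongrightarrow> g x"
  shows "mono_on S g"
  using assms by (intro mono_onI) (meson LIMSEQ_le mono_onD)

text \<open>Two successive limits: the polynomials \<open>P \<rho> N\<close> converge to the moment
  at \<open>\<rho> * x\<close> for fixed \<open>\<rho> < 1\<close>, then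
  \<open>\<rho> = n / (n + 1)\<close> tends to 1. Dilating by \<open>\<rho>\<close> keeps the series
  inside its range on the whole closed interval.\<close>

lemma convex_mono_chord_moment:
  assumes "p > 0"
  shows "convex_on {0..1} (chord_moment p 1)" "mono_on {0..1} (chord_moment p 1)"
proof -
  define c where "c n = (p / 2 gchoose n)\<^sup>2" for n
  define P where "P \<rho> N x = (\<Sum>n<N. c n * (\<rho> * x) ^ (2 * n))" for \<rho> x :: real and N
  have lim: "(\<lambda>N. P \<rho> N x) \<longlonglongrightarrow> chord_moment p 1 (\<rho> * x)" if "0 \<le> \<rho>" "\<rho> < 1" "x \<in> {0..1}" for \<rho> x
  proof -
    have "\<rho> * x < 1"
      using that by (metis atLeastAtMost_iff mult.right_neutral mult_left_mono order_le_less_trans)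
    then show ?thesis
      using chord_moment_series[of "\<rho> * x" p] that by (simp add: P_def c_def)
  qed
  have convex: "convex_on {0..1} (P \<rho> N)" for \<rho> N
  proof -
    have "convex_on {0..1} (\<lambda>x. (c n * \<rho> ^ (2 * n)) * x ^ (2 * n))" for n
      by (intro convex_on_cmul convex_on_subset[OF convex_power_even])
         (auto simp: c_def)
    then show ?thesis
      unfolding P_def power_mult_distrib
      by (induction N) (auto simp: convex_on_const intro!: convex_on_add simp flip: mult.assoc)
  qed
  have mono: "mono_on {0..1} (P \<rho> N)" if "0 \<le> \<rho>" for \<rho> N
    unfolding P_def using that
    by (intro mono_onI sum_mono mult_left_mono power_mono) (auto simp: c_def)
  have \<rho>: "0 \<le> real n / (real n + 1)" "real n / (real n + 1) < 1" for n
    by auto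
  have convex': "convex_on {0..1} (\<lambda>x. chord_moment p 1 (real n / (real n + 1) * x))" for n
    by (rule convex_on_pointwise_limit[OF _ convex lim[OF \<rho>]]) auto
  have mono': "mono_on {0..1} (\<lambda>x. chord_moment p 1 (real n / (real n + 1) * x))" for n
    by (rule mono_on_pointwise_limit[OF mono lim]) (use \<rho>[of n] in auto)
  have lim': "(\<lambda>n. chord_moment p 1 (real n / (real n + 1) * x)) \<longlonglongrightarrow> chord_moment p 1 x" if "x \<in> {0..1}" for x
    using chord_moment_radial_limit[OF assms] that by auto
  show "convex_on {0..1} (chord_moment p 1)"
    by (rule convex_on_pointwise_limit[OF _ convex' lim']) auto
  show "mono_on {0..1} (chord_moment p 1)"
    by (rule mono_on_pointwise_limit[OF mono' lim']) auto
qed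

text \<open>Up to \<open>s\<close>, homogeneity and symmetry reduce the claim to the series result
  at \<open>z / s\<close>; beyond \<open>s\<close> the chords increase pointwise. An interval
  containing \<open>s\<close> is split there.\<close>

lemma chord_moment_mono_left:
  assumes "p > 0" "0 \<le> r" "r \<le> r'" "0 \<le> s"
  shows "chord_moment p r s \<le> chord_moment p r' s"
proof -
  have below: "chord_moment p x s \<le> chord_moment p y s" if "0 \<le> x" "x \<le> y" "y \<le> s" for x y
  proof (cases "s = 0")
    case False
    then have "s > 0" using assms by simp
    have *: "chord_moment p z s = s powr p * chord_moment p 1 (z / s)" for z
      using chord_moment_scale[of s p 1 "z / s"] \<open>s > 0\<close> chord_moment_commute[of p z s] by simp
    show ?thesis
      unfolding * using that \<open>s > 0\<close>
      by (intro mult_left_mono mono_onD[OF convex_mono_chord_moment(2)[OF assms(1)]])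
         (auto simp: divide_right_mono)
  next
    case True
    with that have "x = 0" "y = 0" by auto
    then show ?thesis by simp
  qed
  have above: "chord_moment p x s \<le> chord_moment p y s" if "s \<le> x" "x \<le> y" for x y
    using that assms by (intro chord_moment_mono chord_mono_left) auto
  show ?thesis
    using below[of r r'] below[of r s] above[of s r'] above[of r r'] assms by linarith
qed

section \<open>Subadditivity for positive exponents\<close>

definition chord_norm :: "real \<Rightarrow> real \<Rightarrow> real \<Rightarrow> real" where
  "chord_norm p r s = chord_moment p r s powr (1 / p)"

lemma chord_norm_scale:
  "p > 0 \<Longrightarrow> c \<ge> 0 \<Longrightarrow> chord_norm p (c * r) (c * s) = c * chord_norm p r s"
  by (simp add: chord_norm_def chord_moment_scale powr_mult powr_powr)

lemma chord_norm_commute: "chord_norm p r s = chord_norm p s r"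
  by (simp add: chord_norm_def chord_moment_commute)

lemma chord_norm_mono:
  assumes "p > 0" "0 \<le> r" "r \<le> r'" "0 \<le> s" "s \<le> s'"
  shows "chord_norm p r s \<le> chord_norm p r' s'"
proof -
  have "chord_moment p r s \<le> chord_moment p r' s"
    using assms by (intro chord_moment_mono_left) auto
  also have "\<dots> \<le> chord_moment p r' s'"
    unfolding chord_moment_commute[of p r'] using assms by (intro chord_moment_mono_left) auto
  finally show ?thesis
    unfolding chord_norm_def using assms by (intro powr_mono2 chord_moment_nonneg) auto
qed

lemma convex_on_chord_norm:
  assumes "0 < p" "p \<le> 1"
  shows "convex_on {0..1} (chord_norm p 1)"
proof (rule convex_onI)
  fix u x y :: real assume u: "0 < u" "u < 1" and xy: "x \<in> {0..1}" "y \<in> {0..1}"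
  \<comment> \<open>By monotonicity the moment is at least its value 1 at zero; positivity is used
    when convexity of the power \<open>1 / p\<close> is applied.\<close>
  have pos: "chord_moment p 1 z > 0" if "z \<in> {0..1}" for z
    using mono_onD[OF convex_mono_chord_moment(2)[OF assms(1)], of 0 z] that
    by (auto simp: chord_moment_1_0)
  have "chord_norm p 1 ((1 - u) *\<^sub>R x + u *\<^sub>R y)
      \<le> ((1 - u) * chord_moment p 1 x + u * chord_moment p 1 y) powr (1 / p)"
    unfolding chord_norm_def using u xy assms
    by (intro powr_mono2 chord_moment_nonneg convex_onD[OF convex_mono_chord_moment(1)]) auto
  also have "\<dots> \<le> (1 - u) * chord_norm p 1 x + u * chord_norm p 1 y"
    using convex_onD[OF powr_convex[of "1 / p"], of u "chord_moment p 1 x" "chord_moment p 1 y"]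
      pos[OF xy(1)] pos[OF xy(2)] u assms by (simp add: chord_norm_def)
  finally show "chord_norm p 1 ((1 - u) *\<^sub>R x + u *\<^sub>R y) \<le> (1 - u) * chord_norm p 1 x + u * chord_norm p 1 y" .
qed simp

text \<open>By homogeneity \<open>chord_norm p r s\<close> is \<open>r\<close> times a convex
  function of \<open>s / r\<close>, that is, its perspective. The slope of the sum is the average of
  the two slopes with weights proportional to \<open>r\<close> and \<open>r'\<close>. If
  \<open>r\<close> or \<open>r'\<close> vanishes, so does its partner.\<close>

lemma chord_norm_add_sector:
  assumes p: "0 < p" "p \<le> 1" and "0 \<le> s" "s \<le> r" "0 \<le> s'" "s' \<le> r'"
  shows "chord_norm p (r + r') (s + s') \<le> chord_norm p r s + chord_norm p r' s'"
proof -
  have zero: "chord_norm p 0 0 = 0"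
    using chord_norm_scale[of p 0 0 0] p by simp
  consider "r = 0" | "r' = 0" | "r > 0" "r' > 0"
    using assms by linarith
  then show ?thesis
  proof cases
    case 3
    define u where "u = r' / (r + r')"
    have u: "0 \<le> u" "u \<le> 1" "(r + r') * u = r'" "(r + r') * (1 - u) = r"
      using 3 by (auto simp: u_def field_simps)
    have norm: "chord_norm p x y = x * chord_norm p 1 (y / x)" if "x > 0" for x y
      using chord_norm_scale[of p x 1 "y / x"] p that by simp
    have "1 - u = r / (r + r')"
      using 3 by (simp add: u_def field_simps)
    then have "(s + s') / (r + r') = (1 - u) * (s / r) + u * (s' / r')"
      using 3 by (simp add: u_def add_divide_distrib)
    then have "chord_norm p 1 ((s + s') / (r + r'))
        \<le> (1 - u) * chord_norm p 1 (s / r) + u * chord_norm p 1 (s' / r')"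
      using convex_onD[OF convex_on_chord_norm[OF p], of u "s / r" "s' / r'"] u assms 3 by simp
    then have "(r + r') * chord_norm p 1 ((s + s') / (r + r'))
        \<le> (r + r') * ((1 - u) * chord_norm p 1 (s / r) + u * chord_norm p 1 (s' / r'))"
      using 3 by (intro mult_left_mono) auto
    also have "\<dots> = r * chord_norm p 1 (s / r) + r' * chord_norm p 1 (s' / r')"
      by (simp add: distrib_left u flip: mult.assoc)
    finally show ?thesis
      using 3 norm[of r s] norm[of r' s'] norm[of "r + r'" "s + s'"] by simp
  qed (use assms zero in auto)
qed

lemma chord_norm_add:
  assumes p: "0 < p" "p \<le> 1" and nn: "0 \<le> r" "0 \<le> s" "0 \<le> r'" "0 \<le> s'"
  shows "chord_norm p (r + r') (s + s') \<le> chord_norm p r s + chord_norm p r' s'"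
proof -
  \<comment> \<open>Reflecting the second pair keeps the total of the coordinates and lowers their
    product by \<open>(x - y) * (y' - x')\<close>, so the chord grows and both pairs lie in one
    sector.\<close>
  have mixed: "chord_norm p (x + x') (y + y') \<le> chord_norm p x y + chord_norm p x' y'"
    if "0 \<le> y" "y \<le> x" "0 \<le> x'" "x' \<le> y'" for x y x' y'
  proof -
    have "(x + y') * (y + x') \<le> (x + x') * (y + y')"
      using mult_nonneg_nonneg[of "x - y" "y' - x'"] that by (simp add: algebra_simps)
    then have "chord_norm p (x + x') (y + y') \<le> chord_norm p (x + y') (y + x')"
      unfolding chord_norm_def using p
      by (intro powr_mono2 chord_moment_nonneg chord_moment_mono chord_mono_spread) auto
    also have "\<dots> \<le> chord_norm p x y + chord_norm p y' x'"
      using that p by (intro chord_norm_add_sector) auto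
    finally show ?thesis
      by (simp add: chord_norm_commute[of p y'])
  qed
  consider "s \<le> r" "s' \<le> r'" | "r \<le> s" "r' \<le> s'" | "s \<le> r" "r' \<le> s'" | "r \<le> s" "s' \<le> r'"
    by linarith
  then show ?thesis
  proof cases
    case 1
    then show ?thesis using assms by (intro chord_norm_add_sector) auto
  next
    case 2
    then show ?thesis
      using chord_norm_add_sector[of p r s r' s'] assms by (simp add: chord_norm_commute)
  next
    case 3
    then show ?thesis using mixed nn by auto
  next
    case 4
    then show ?thesis
      using mixed[where x = r' and y = s' and x' = r and y' = s] nn by (simp add: add.commute)
  qed
qed

section \<open>Exponent zero: Jensen's formula\<close>

text \<open>\<open>ln (chord 1 x t)\<close> is the real part of the logarithm of
  \<open>1 + x e^(it)\<close>, whose power series has no constant term. A geometric bound permits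
  integrating term by term, and every cosine has mean zero.\<close>

lemma integral_ln_chord_inside:
  assumes x: "0 \<le> x" "x < 1"
  shows "integrable angle_measure (\<lambda>t. ln (chord 1 x t))" "(\<integral>t. ln (chord 1 x t) \<partial>angle_measure) = 0"
proof -
  \<comment> \<open>Division by zero makes \<open>a 0 = 0\<close>, so the constant term is indeed
    absent.\<close>
  define a where "a n = - ((- x) ^ n) / real n" for n
  have pos: "1 + of_real x * cis t \<noteq> 0" for t
  proof
    assume "1 + of_real x * cis t = 0"
    then have "cmod (of_real x * cis t) = 1"
      by (metis add_eq_0_iff norm_minus_cancel norm_one)
    then show False using x by (simp add: norm_mult)
  qed
  have lim: "(\<lambda>N. \<Sum>n<N. a n * cos (of_int (int n) * t)) \<longlonglongrightarrow> ln (chord 1 x t)" for t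
  proof -
    have "(\<lambda>n. - ((- (of_real x * cis t)) ^ n) / of_nat n) sums ln (1 + of_real x * cis t)"
      using x by (intro Ln_series') (simp add: norm_mult)
    then have "(\<lambda>n. Re (- ((- (of_real x * cis t)) ^ n) / of_nat n)) sums Re (ln (1 + of_real x * cis t))"
      by (rule sums_Re)
    moreover have "- ((- (of_real x * cis t)) ^ n) / of_nat n = of_real (a n) * cis (real n * t)" for n
    proof -
      have "(- (of_real x * cis t)) ^ n = of_real ((- x) ^ n) * cis (real n * t)"
        by (metis Complex.DeMoivre mult_minus_left of_real_minus of_real_power power_mult_distrib)
      then show ?thesis by (simp add: a_def)
    qed
    ultimately show ?thesis
      using pos[of t] by (simp only: Re_Ln chord_eq_cmod sums_def) simp
  qed
  have bound: "\<bar>\<Sum>n<N. a n * cos (of_int (int n) * t)\<bar> \<le> 1 / (1 - x)" for N t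
  proof -
    have "\<bar>a n * cos (of_int (int n) * t)\<bar> \<le> x ^ n" for n
    proof -
      have "\<bar>a n\<bar> = x ^ n / real n"
        using x by (simp add: a_def abs_divide power_abs)
      also have "\<dots> \<le> x ^ n"
        using x mult_right_mono[of 1 "real n" "x ^ n"] by (cases "n = 0") (auto simp: divide_le_eq mult.commute)
      finally have "\<bar>a n\<bar> * \<bar>cos (of_int (int n) * t)\<bar> \<le> x ^ n * 1"
        using x by (intro mult_mono) auto
      then show ?thesis by (simp add: abs_mult)
    qed
    then have "\<bar>\<Sum>n<N. a n * cos (of_int (int n) * t)\<bar> \<le> (\<Sum>n<N. x ^ n)"
      by (intro order_trans[OF sum_abs] sum_mono) auto
    also have "\<dots> \<le> (\<Sum>n. x ^ n)"
      using x by (intro sum_le_suminf summable_geometric) auto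
    also have "\<dots> = 1 / (1 - x)"
      using x by (intro suminf_geometric) auto
    finally show ?thesis .
  qed
  note dom = AE_I2[OF lim] and const = finite_measure.integrable_const[OF finite_measure_angle, of "1 / (1 - x)"]
  show "integrable angle_measure (\<lambda>t. ln (chord 1 x t))"
    by (rule integrable_dominated_convergence[OF _ _ const dom]) (use bound in auto)
  have "(\<lambda>N. \<integral>t. (\<Sum>n<N. a n * cos (of_int (int n) * t)) \<partial>angle_measure)
      \<longlonglongrightarrow> (\<integral>t. ln (chord 1 x t) \<partial>angle_measure)"
    by (rule integral_dominated_convergence[OF _ _ const dom]) (use bound in auto)
  moreover have "(\<integral>t. (\<Sum>n<N. a n * cos (of_int (int n) * t)) \<partial>angle_measure) = 0" for N
  proof -
    have "(\<integral>t. (\<Sum>n<N. a n * cos (of_int (int n) * t)) \<partial>angle_measure)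
        = (\<Sum>n<N. a n * of_bool (int n = 0))"
      unfolding integral_cos_angle[symmetric]
      by (simp add: integrable_cos_angle del: of_int_of_nat_eq)
    also have "\<dots> = 0"
      by (intro sum.neutral) (auto simp: a_def)
    finally show ?thesis .
  qed
  ultimately show "(\<integral>t. ln (chord 1 x t) \<partial>angle_measure) = 0"
    by (simp add: LIMSEQ_const_iff)
qed

text \<open>The only zero in the interval is \<open>t = pi\<close>, a null set.\<close>

lemma AE_chord_1_1_pos: "AE t in angle_measure. chord 1 1 t > 0"
proof (rule AE_uniform_measureI)
  show "AE t in lborel. t \<in> {0..2*pi} \<longrightarrow> chord 1 1 t > 0"
    using AE_lborel_singleton[of pi]
  proof (eventually_elim, intro impI)
    fix t assume t: "t \<noteq> pi" "t \<in> {0..2*pi}"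
    have "cos t \<noteq> - 1"
    proof
      assume "cos t = - 1"
      then obtain n :: int where n: "t = (2 * n + 1) * pi"
        using cos_eq_minus1 by auto
      then have "0 \<le> 2 * real_of_int n + 1" "2 * real_of_int n + 1 \<le> 2"
        using t pi_gt_zero by (auto simp: zero_le_mult_iff simp del: pi_gt_zero)
      then have "n = 0" by linarith
      with n t show False by simp
    qed
    then have "cos t > - 1"
      using cos_ge_minus_one[of t] by linarith
    then show "chord 1 1 t > 0"
      by (simp add: chord_def)
  qed
qed simp

lemma chord_pos: "0 \<le> x \<Longrightarrow> x < 1 \<Longrightarrow> chord 1 x t > 0"
proof -
  assume x: "0 \<le> x" "x < 1"
  have "1 - x \<le> chord 1 x t"
    unfolding chord_eq_cmod using norm_diff_ineq[of 1 "of_real x * cis t"] x by (simp add: norm_mult)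
  then show ?thesis using x by simp
qed

text \<open>On the boundary the integrability comes from monotone convergence: \<open>chord 1 x t / (1 + x)\<close>
  decreases in \<open>x\<close>.\<close>

lemma integral_ln_chord_boundary:
  "integrable angle_measure (\<lambda>t. ln (chord 1 1 t))" "(\<integral>t. ln (chord 1 1 t) \<partial>angle_measure) = 0"
proof -
  define \<rho> where "\<rho> n = real n / (real n + 1)" for n
  have \<rho>: "0 \<le> \<rho> n" "\<rho> n < 1" for n
    by (auto simp: \<rho>_def)
  have \<rho>_lim: "\<rho> \<longlonglongrightarrow> 1"
    unfolding \<rho>_def using LIMSEQ_n_over_Suc_n by (simp add: add.commute)
  have \<rho>_mono: "\<rho> m \<le> \<rho> n" if "m \<le> n" for m n
    using that by (simp add: \<rho>_def field_simps)
  \<comment> \<open>The negated logarithm of the normalized chord: increasing in \<open>n\<close>,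
    with integral \<open>ln (1 + \<rho> n)\<close> because the inner mean is zero.\<close>
  define f where "f n t = ln (1 + \<rho> n) - ln (chord 1 (\<rho> n) t)" for n t
  have int: "integrable angle_measure (f n)" for n
    unfolding f_def using integral_ln_chord_inside(1)[OF \<rho>]
      finite_measure.integrable_const[OF finite_measure_angle] by (intro Bochner_Integration.integrable_diff)
  have val: "integral\<^sup>L angle_measure (f n) = ln (1 + \<rho> n)" for n
    unfolding f_def using integral_ln_chord_inside[OF \<rho>]
      finite_measure.integrable_const[OF finite_measure_angle] by (subst Bochner_Integration.integral_diff) auto
  have mono: "f m t \<le> f n t" if "m \<le> n" for m n t
  proof -
    let ?x = "\<rho> m" and ?y = "\<rho> n"
    have "?x * ?y \<le> 1"
      using \<rho>[of m] \<rho>[of n] by (intro mult_le_one) auto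
    then have "0 \<le> (?y - ?x) * (1 - ?x * ?y)"
      using \<rho>_mono[OF that] by simp
    \<comment> \<open>The sides \<open>1 + ?x\<close>, \<open>(1 + ?x) * ?y\<close> and the sides
      \<open>1 + ?y\<close>, \<open>(1 + ?y) * ?x\<close> have the same sum. Their products differ
      by \<open>(?y - ?x) * (1 - ?x * ?y)\<close>, so \<open>chord_mono_spread\<close> compares the
      chords.\<close>
    then have le: "((1 + ?y) * 1) * ((1 + ?y) * ?x) \<le> ((1 + ?x) * 1) * ((1 + ?x) * ?y)"
      by (simp add: algebra_simps)
    have "(1 + ?x) * chord 1 ?y t \<le> (1 + ?y) * chord 1 ?x t"
      using chord_mono_spread[OF _ le, of t] \<rho>[of m] \<rho>[of n]
      by (simp only: chord_scale add_nonneg_nonneg zero_le_one) (simp add: algebra_simps)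
    then have "ln ((1 + ?x) * chord 1 ?y t) \<le> ln ((1 + ?y) * chord 1 ?x t)"
      using \<rho>[of m] \<rho>[of n] chord_pos[OF \<rho>] by (subst ln_le_cancel_iff) (auto intro!: mult_pos_pos add_pos_nonneg)
    moreover have "1 + ?x > 0" "1 + ?y > 0"
      using \<rho>[of m] \<rho>[of n] by auto
    ultimately show ?thesis
      using chord_pos[OF \<rho>[of m], of t] chord_pos[OF \<rho>[of n], of t] by (simp add: f_def ln_mult)
  qed
  have lim: "AE t in angle_measure. (\<lambda>n. f n t) \<longlonglongrightarrow> ln 2 - ln (chord 1 1 t)"
    using AE_chord_1_1_pos
  proof eventually_elim
    fix t assume "chord 1 1 t > 0"
    moreover have "(\<lambda>n. chord 1 (\<rho> n) t) \<longlonglongrightarrow> chord 1 1 t"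
      unfolding chord_eq_cmod using \<rho>_lim by (intro tendsto_intros)
    moreover have "(\<lambda>n. 1 + \<rho> n) \<longlonglongrightarrow> 1 + 1"
      using \<rho>_lim by (intro tendsto_intros)
    ultimately show "(\<lambda>n. f n t) \<longlonglongrightarrow> ln 2 - ln (chord 1 1 t)"
      unfolding f_def by (intro tendsto_diff tendsto_ln) auto
  qed
  have vlim: "(\<lambda>n. integral\<^sup>L angle_measure (f n)) \<longlonglongrightarrow> ln 2"
  proof -
    have "(\<lambda>n. ln (1 + \<rho> n)) \<longlonglongrightarrow> ln (1 + 1)"
      using \<rho>_lim by (intro tendsto_intros) auto
    then show ?thesis by (simp add: val)
  qed
  have "has_bochner_integral angle_measure (\<lambda>t. ln 2 - ln (chord 1 1 t)) (ln 2)"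
    by (rule has_bochner_integral_monotone_convergence[OF int _ lim vlim]) (auto simp: mono_def mono)
  then have "has_bochner_integral angle_measure (\<lambda>t. ln 2 - (ln 2 - ln (chord 1 1 t))) (ln 2 - ln 2)"
    by (intro has_bochner_integral_diff)
       (simp_all add: has_bochner_integral_iff finite_measure.integrable_const[OF finite_measure_angle])
  then show "integrable angle_measure (\<lambda>t. ln (chord 1 1 t))" "(\<integral>t. ln (chord 1 1 t) \<partial>angle_measure) = 0"
    by (simp_all add: has_bochner_integral_iff)
qed

text \<open>Factoring out \<open>r\<close> leaves \<open>ln r\<close> plus the mean of
  \<open>ln (chord 1 (s / r) t)\<close>, which is zero.\<close>

lemma eexp_integral_elog_chord_sector:
  assumes "0 \<le> s" "s \<le> r"
  shows "eexp (ereal_integral angle_measure (\<lambda>t. elog (chord r s t))) = r"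
proof (cases "r = 0")
  \<comment> \<open>The integrand is constantly minus infinity on a space of mass 1, so
    \<open>eexp\<close> returns 0.\<close>
  case True
  with assms have "chord r s t = 0" for t
    by (simp add: chord_def)
  moreover have "emeasure angle_measure UNIV = 1"
    using emeasure_uniform_measure_1[of lborel "{0..2*pi}"]
    by (simp add: ennreal_divide_self)
  ultimately show ?thesis
    using True by (simp add: ereal_integral_def elog_def e2ennreal_neg e2ennreal_infty eexp_def zero_ennreal.rep_eq)
next
  case False
  then have "r > 0" using assms by simp
  define x where "x = s / r"
  have x: "0 \<le> x" "x \<le> 1"
    using assms \<open>r > 0\<close> by (auto simp: x_def)
  have chord: "chord r s t = r * chord 1 x t" for t
    using chord_scale[of r 1 x t] \<open>r > 0\<close> by (simp add: x_def)
  have pos: "AE t in angle_measure. chord 1 x t > 0"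
    using x AE_chord_1_1_pos chord_pos[of x] by (cases "x = 1") auto
  have int: "integrable angle_measure (\<lambda>t. ln (chord 1 x t))" and val: "(\<integral>t. ln (chord 1 x t) \<partial>angle_measure) = 0"
    using x integral_ln_chord_boundary integral_ln_chord_inside[of x] by (cases "x = 1"; force)+
  have const: "integrable angle_measure (\<lambda>_. ln r)"
    by (rule finite_measure.integrable_const[OF finite_measure_angle])
  \<comment> \<open>Only almost everywhere: for \<open>x = 1\<close> the chord vanishes at
    \<open>pi\<close>, where \<open>ln 0 = 0\<close> would break additivity.\<close>
  have ae: "AE t in angle_measure. ln (chord r s t) = ln r + ln (chord 1 x t)"
    using pos by eventually_elim (use \<open>r > 0\<close> in \<open>simp add: chord ln_mult\<close>)
  have "integrable angle_measure (\<lambda>t. ln (chord r s t)) \<longleftrightarrow> integrable angle_measure (\<lambda>t. ln r + ln (chord 1 x t))"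
    by (rule integrable_cong_AE[OF _ _ ae]) auto
  moreover have "(\<integral>t. ln (chord r s t) \<partial>angle_measure) = (\<integral>t. ln r + ln (chord 1 x t) \<partial>angle_measure)"
    by (rule integral_cong_AE[OF _ _ ae]) auto
  moreover have "AE t in angle_measure. chord r s t > 0"
    using pos by eventually_elim (use \<open>r > 0\<close> in \<open>simp add: chord\<close>)
  ultimately show ?thesis
    using int val const \<open>r > 0\<close> by (simp add: eexp_integral_elog_real)
qed

text \<open>The singular values of \<open>A\<close> are the sum and the absolute difference of these
  moduli, so this is half the trace norm.\<close>

lemma Hp_norm_0_eq_max: "Hp_norm 0 A = max (cmod (hol_part A)) (cmod (antihol_part A))"
proof (cases "cmod (antihol_part A) \<le> cmod (hol_part A)")
  case True
  then show ?thesis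
    by (simp add: Hp_norm_0_eq_chord eexp_integral_elog_chord_sector)
next
  case False
  then show ?thesis
    using eexp_integral_elog_chord_sector[of "cmod (hol_part A)" "cmod (antihol_part A)"]
    by (simp add: Hp_norm_0_eq_chord chord_commute[of "cmod (hol_part A)"])
qed

section \<open>The triangle inequality for matrices\<close>

theorem corollary5p2:
  fixes p :: real and A B :: "real^2^2"
  assumes "0 \<le> p" and "p < 1"
  shows "Hp_norm p (A + B) \<le> Hp_norm p A + Hp_norm p B"
proof -
  have le: "cmod (hol_part (A + B)) \<le> cmod (hol_part A) + cmod (hol_part B)"
    "cmod (antihol_part (A + B)) \<le> cmod (antihol_part A) + cmod (antihol_part B)"
    by (simp_all add: hol_part_add antihol_part_add norm_triangle_ineq)
  show ?thesis
  proof (cases "p = 0")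
    case True
    with le show ?thesis by (simp only: Hp_norm_0_eq_max)
  next
    case False
    have norm: "Hp_norm p M = chord_norm p (cmod (hol_part M)) (cmod (antihol_part M))" for M
      using Hp_norm_eq_chord_moment[OF False] by (simp add: chord_norm_def)
    have "chord_norm p (cmod (hol_part (A + B))) (cmod (antihol_part (A + B)))
        \<le> chord_norm p (cmod (hol_part A) + cmod (hol_part B)) (cmod (antihol_part A) + cmod (antihol_part B))"
      using assms False le by (intro chord_norm_mono) auto
    also have "\<dots> \<le> chord_norm p (cmod (hol_part A)) (cmod (antihol_part A))
        + chord_norm p (cmod (hol_part B)) (cmod (antihol_part B))"
      using assms False by (intro chord_norm_add) auto
    finally show ?thesis
      by (simp add: norm)
  qed
qed

end
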